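(* Consider a change of size $\delta\in\mathbb R^p$ at time $\tau^*$, that is $y_t=\varepsilon_t$ for $t\le\tau^*$ and $y_t=\delta+\varepsilon_t$ for $t>\tau^*$, with $\varepsilon_t$ i.i.d. $\mathcal N_p(0,I_p)$ and $\lVert\delta\rVert>0$. Denote by $T$ the first time the thresholded statistic with known pre-change mean $0$, $S^{(a)}_{\tau,n}(0)$, passes the fixed threshold $c$. With probability at least $1-\alpha$ the detection delay $T-\tau^*$ is less than $$\log_2(p)\,\max\left\{\frac{2c-8\log(\alpha)+8\log\big(2(z(\delta)+1)\big)}{\lVert\delta\rVert^2},\ \frac{2a^2-8\log(\alpha)+8\log\big(2(z(\delta)+1)\big)}{\lVert\delta\rVert^2/z(\delta)}\right\},$$ where $z(\delta)$ is the effective sparsity of $\delta$.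
   Context: $\lVert\cdot\rVert$ is the Euclidean norm and $\alpha\in(0,1)$. For a candidate change $\tau<n$ and coordinate $i$, $O^i_{\tau,n}(0)=\frac1{\sqrt{n-\tau}}\sum_{t=\tau+1}^n y_t^i$ (with $y_t^i$ the $i$-th coordinate of $y_t$), and the thresholded statistic at time $n$ is $S^{(a)}_{\tau,n}(0)=\sum_{i=1}^p\big(O^i_{\tau,n}(0)\big)^2\,\mathbb 1_{|O^i_{\tau,n}(0)|\ge a}$. $T$ is the first time $n$ at which $S^{(a)}_{\tau,n}(0)\ge c$ for some candidate change $\tau<n$. Effective sparsity: for any $\delta\in\mathbb R^p$ with $\lVert\delta\rVert>0$, $z(\delta)$ is the smallest integer in $\{2^0,2^1,\dots,2^{\lfloor\log_2(p)\rfloor}\}$ such that the set $\mathcal Z(\delta)=\big\{j:\ |\delta^j|>\lVert\delta\rVert/\sqrt{z(\delta)\log_2(p)}\big\}$ has cardinality at least $z(\delta)$.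
   Formalization: Times are integers, so the strict delay bound can fail when small (e.g. bound at most 1, change at time 0); it is proved strictly when the bound exceeds 3, and in general as at most the bound rounded up. Existence of z(δ) and p ≥ 2 are assumed, as z(δ) is otherwise undefined. *)

theory Defs
  imports "HOL-Probability.Probability" "HOL-Library.Extended_Nat"
begin

text \<open>Vectors of dimension \<open>p\<close> are elements of \<open>real ^ 'p\<close> with \<open>p = CARD('p)\<close>. A data stream is
  a function \<open>y\<close> on time points \<open>t = 1, 2, \<dots>\<close>; its value at \<open>t = 0\<close> is never used.\<close>

definition std_mvnormal :: "(real ^ 'p) measure" where
  "std_mvnormal =
     density lborel (\<lambda>x. ennreal (1 / sqrt (2 * pi) ^ CARD('p) * exp (- (norm x)\<^sup>2 / 2)))"

definition iid_std_mvnormal :: "'w measure \<Rightarrow> (nat \<Rightarrow> 'w \<Rightarrow> real ^ 'p) \<Rightarrow> bool" where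
  "iid_std_mvnormal M \<epsilon> \<longleftrightarrow>
     prob_space.indep_vars M (\<lambda>_. borel) \<epsilon> {1..} \<and>
     (\<forall>t\<ge>1. distr M borel (\<epsilon> t) = std_mvnormal)"

definition mean_shift :: "nat \<Rightarrow> real ^ 'p \<Rightarrow> (nat \<Rightarrow> real ^ 'p) \<Rightarrow> nat \<Rightarrow> real ^ 'p" where
  "mean_shift \<tau> \<delta> e t = (if t \<le> \<tau> then e t else \<delta> + e t)"

definition cusum :: "(nat \<Rightarrow> real ^ 'p) \<Rightarrow> nat \<Rightarrow> nat \<Rightarrow> 'p \<Rightarrow> real" where
  "cusum y \<tau> n i = 1 / sqrt (real (n - \<tau>)) * (\<Sum>t = \<tau> + 1..n. y t $ i)"

definition thresholded_stat :: "real \<Rightarrow> (nat \<Rightarrow> real ^ 'p) \<Rightarrow> nat \<Rightarrow> nat \<Rightarrow> real" where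
  "thresholded_stat a y \<tau> n =
     (\<Sum>i\<in>UNIV. (cusum y \<tau> n i)\<^sup>2 * (if \<bar>cusum y \<tau> n i\<bar> \<ge> a then 1 else 0))"

text \<open>The candidate changes at time \<open>n\<close> are \<open>\<tau> = 0, \<dots>, n - 1\<close>. The infimum in \<^typ>\<open>enat\<close> is
  \<open>\<infinity>\<close> when the threshold is never reached.\<close>

definition detection_time :: "real \<Rightarrow> real \<Rightarrow> (nat \<Rightarrow> real ^ 'p) \<Rightarrow> enat" where
  "detection_time a c y = Inf (enat ` {n. \<exists>\<tau><n. thresholded_stat a y \<tau> n \<ge> c})"

definition large_coords :: "real ^ 'p \<Rightarrow> nat \<Rightarrow> 'p set" where
  "large_coords \<delta> z = {j. \<bar>\<delta> $ j\<bar> > norm \<delta> / sqrt (real z * log 2 (real CARD('p)))}"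

definition sparsity_levels :: "real ^ 'p \<Rightarrow> nat set" where
  "sparsity_levels \<delta> =
     {z \<in> (\<lambda>k. 2 ^ k) ` {0..nat \<lfloor>log 2 (real CARD('p))\<rfloor>}. card (large_coords \<delta> z) \<ge> z}"

text \<open>The minimum is meaningful only when \<^term>\<open>sparsity_levels \<delta>\<close> is nonempty. This can fail:
  for \<open>p = 2\<close> it is empty for every nonzero \<open>\<delta>\<close>, and for \<open>p = 3\<close> it is empty for
  \<open>\<delta> = (3, 2, 2)\<close>.\<close>

definition effective_sparsity :: "real ^ 'p \<Rightarrow> nat" where
  "effective_sparsity \<delta> = (LEAST z. z \<in> sparsity_levels \<delta>)"

text \<open>The bound is a real number, while a delay is an integer, and at least \<open>1\<close> when there is no
  alarm up to the change. As the bound is proportional to \<open>1 / \<parallel>\<delta>\<parallel>\<^sup>2\<close>, it can be below \<open>1\<close>, so a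
  delay strictly below the bound can only be claimed when the bound is not too small; in
  general the bound has to be rounded up.\<close>

definition delay_bound :: "real \<Rightarrow> real \<Rightarrow> real \<Rightarrow> real ^ 'p \<Rightarrow> real" where
  "delay_bound a c \<alpha> \<delta> =
     (let z = real (effective_sparsity \<delta>) in
      log 2 (real CARD('p)) *
      max ((2 * c - 8 * ln \<alpha> + 8 * ln (2 * (z + 1))) / (norm \<delta>)\<^sup>2)
          ((2 * a\<^sup>2 - 8 * ln \<alpha> + 8 * ln (2 * (z + 1))) / ((norm \<delta>)\<^sup>2 / z)))"

end

theory Submission
  imports Defs
begin

text \<open>Monitor only the true change point \<open>\<tau>\<close>, \<open>m\<close> observations after it: coordinate \<open>i\<close> of the
  statistic is \<open>\<surd>m \<delta>\<^sup>i\<close> plus standard normal noise. Pick \<open>z = z(\<delta>)\<close> of the large coordinates and let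
  \<open>D\<close> be the restriction of \<open>\<delta>\<close> to them. Project the noise onto these \<open>z\<close> coordinate axes and onto
  the direction of \<open>D\<close>: by a Chernoff and a union bound all \<open>z + 1\<close> projections against the signal
  stay above \<open>- b\<close> with \<open>b\<^sup>2 = 2 log (2 (z + 1) / \<alpha>)\<close>, except with probability \<open>\<alpha> / 2\<close>. Then each
  chosen coordinate passes \<open>a\<close>, and Cauchy-Schwarz against \<open>D\<close> gives a sum of squares of at least
  \<open>(\<surd>m \<parallel>D\<parallel> - b)\<^sup>2 \<ge> c\<close>. Both deterministic inequalities only need \<open>m\<close> to be at least three
  quarters of the bound, which leaves room for rounding it to an integer.\<close>

section \<open>Exponential moments and tails of the Gaussian noise\<close>

text \<open>Completing the square turns the tilted density into a constant times a translate of the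
  original one, and Lebesgue measure is translation invariant. The total mass 1 comes from the
  \<open>prob_space\<close> assumption rather than from a Gaussian integral; in the application the
  measure is the law of a random vector.\<close>

lemma std_mvnormal_mgf:
  fixes w :: "real ^ 'p"
  assumes "prob_space (std_mvnormal :: (real ^ 'p) measure)"
  shows "(\<integral>\<^sup>+x. ennreal (exp (w \<bullet> x)) \<partial>std_mvnormal) = ennreal (exp ((norm w)\<^sup>2 / 2))"
proof -
  define f :: "real ^ 'p \<Rightarrow> real"
    where "f x = 1 / sqrt (2 * pi) ^ CARD('p) * exp (- (norm x)\<^sup>2 / 2)" for x
  have f_nonneg: "f x \<ge> 0" for x
    by (simp add: f_def)
  have [measurable]: "f \<in> borel_measurable borel"
    unfolding f_def by measurable
  have std: "std_mvnormal = density lborel (\<lambda>x. ennreal (f x))"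
    by (simp add: std_mvnormal_def f_def)
  have total: "(\<integral>\<^sup>+x. ennreal (f x) \<partial>lborel) = 1"
    using prob_space.emeasure_space_1[OF assms] by (simp add: std emeasure_density)
  have square: "f x * exp (w \<bullet> x) = exp ((norm w)\<^sup>2 / 2) * f (- w + x)" for x
  proof -
    have "(norm (- w + x))\<^sup>2 = (norm w)\<^sup>2 - 2 * (w \<bullet> x) + (norm x)\<^sup>2"
      by (simp add: power2_norm_eq_inner inner_simps inner_commute)
    then have "- (norm x)\<^sup>2 / 2 + w \<bullet> x = (norm w)\<^sup>2 / 2 + - (norm (- w + x))\<^sup>2 / 2"
      by argo
    then have "exp (- (norm x)\<^sup>2 / 2) * exp (w \<bullet> x)
        = exp ((norm w)\<^sup>2 / 2) * exp (- (norm (- w + x))\<^sup>2 / 2)"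
      by (metis exp_add)
    then show ?thesis
      by (simp add: f_def)
  qed
  have "(\<integral>\<^sup>+x. ennreal (exp (w \<bullet> x)) \<partial>std_mvnormal)
      = (\<integral>\<^sup>+x. ennreal (f x * exp (w \<bullet> x)) \<partial>lborel)"
    by (simp add: std nn_integral_density ennreal_mult' f_nonneg)
  also have "\<dots> = (\<integral>\<^sup>+x. ennreal (exp ((norm w)\<^sup>2 / 2)) * ennreal (f (- w + x)) \<partial>lborel)"
    by (simp add: square ennreal_mult')
  also have "\<dots> = ennreal (exp ((norm w)\<^sup>2 / 2)) * (\<integral>\<^sup>+x. ennreal (f (- w + x)) \<partial>lborel)"
    by (simp add: nn_integral_cmult)
  also have "(\<integral>\<^sup>+x. ennreal (f (- w + x)) \<partial>lborel)
      = (\<integral>\<^sup>+x. ennreal (f x) \<partial>distr lborel borel ((+) (- w)))"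
    by (simp add: nn_integral_distr)
  also have "\<dots> = 1"
    by (simp only: lborel_distr_plus total)
  finally show ?thesis
    by simp
qed

lemma iid_std_mvnormal_measurable:
  assumes "prob_space M" and "iid_std_mvnormal M \<epsilon>" and "t \<ge> 1"
  shows "\<epsilon> t \<in> borel_measurable M"
  using assms(2,3) unfolding iid_std_mvnormal_def prob_space.indep_vars_def2[OF assms(1)] by auto

text \<open>Chernoff bound: independence factorises the exponential moment over the \<open>m\<close>
  summands, and Markov's inequality does the rest.\<close>

lemma iid_std_mvnormal_tail:
  fixes v :: "real ^ 'p"
  assumes M: "prob_space M" and iid: "iid_std_mvnormal M \<epsilon>"
    and v: "norm v = 1" and m: "m \<ge> 1" and b: "b \<ge> 0"
  shows "measure M {\<omega> \<in> space M. v \<bullet> (\<Sum>t = \<tau> + 1..\<tau> + m. \<epsilon> t \<omega>) \<le> - (sqrt m * b)}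
      \<le> exp (- b\<^sup>2 / 2)"
proof -
  interpret prob_space M by fact
  define I where "I = {\<tau> + 1..\<tau> + m}"
  \<comment> \<open>The length \<open>b / sqrt m\<close> minimises the Chernoff exponent
    \<open>m * l\<^sup>2 / 2 - l * sqrt m * b\<close> over \<open>l\<close>; the sign turns the
    lower tail into an upper one.\<close>
  define w where "w = - (b / sqrt m) *\<^sub>R v"
  have I: "finite I" "card I = m" "I \<subseteq> {1..}" "\<And>t. t \<in> I \<Longrightarrow> t \<ge> 1"
    by (auto simp: I_def)
  have eps[measurable]: "\<epsilon> t \<in> borel_measurable M" if "t \<in> I" for t
    using iid_std_mvnormal_measurable[OF M iid] I(4) that by auto
  have factor: "(\<integral>\<^sup>+\<omega>. ennreal (exp (w \<bullet> \<epsilon> t \<omega>)) \<partial>M) = ennreal (exp (b\<^sup>2 / (2 * m)))"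
    if t: "t \<in> I" for t
  proof -
    have d: "distr M borel (\<epsilon> t) = std_mvnormal"
      using iid I(4)[OF t] by (simp add: iid_std_mvnormal_def)
    have "(\<integral>\<^sup>+\<omega>. ennreal (exp (w \<bullet> \<epsilon> t \<omega>)) \<partial>M)
        = (\<integral>\<^sup>+x. ennreal (exp (w \<bullet> x)) \<partial>distr M borel (\<epsilon> t))"
      using eps[OF t] by (simp add: nn_integral_distr)
    also have "\<dots> = ennreal (exp ((norm w)\<^sup>2 / 2))"
      using prob_space_distr[OF eps[OF t]] unfolding d by (rule std_mvnormal_mgf)
    also have "(norm w)\<^sup>2 / 2 = b\<^sup>2 / (2 * m)"
      using m by (simp add: w_def v power_divide)
    finally show ?thesis .
  qed
  have "indep_vars (\<lambda>_. borel) \<epsilon> I"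
    using iid I(3) unfolding iid_std_mvnormal_def by (blast intro: indep_vars_subset)
  then have indep: "indep_vars (\<lambda>_. borel) (\<lambda>t \<omega>. ennreal (exp (w \<bullet> \<epsilon> t \<omega>))) I"
    by (rule indep_vars_compose2) simp
  have "(\<integral>\<^sup>+\<omega>. ennreal (exp (w \<bullet> (\<Sum>t\<in>I. \<epsilon> t \<omega>))) \<partial>M)
      = (\<integral>\<^sup>+\<omega>. (\<Prod>t\<in>I. ennreal (exp (w \<bullet> \<epsilon> t \<omega>))) \<partial>M)"
    using I(1) by (simp add: inner_sum_right exp_sum prod_ennreal)
  also have "\<dots> = (\<Prod>t\<in>I. \<integral>\<^sup>+\<omega>. ennreal (exp (w \<bullet> \<epsilon> t \<omega>)) \<partial>M)"
    by (rule indep_vars_nn_integral[OF I(1) indep]) simp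
  also have "\<dots> = ennreal (exp (b\<^sup>2 / (2 * m)) ^ m)"
    by (simp add: factor I(2) ennreal_power)
  also have "exp (b\<^sup>2 / (2 * m)) ^ m = exp (b\<^sup>2 / 2)"
    using m by (simp only: exp_of_nat_mult[symmetric]) simp
  finally have mgf: "(\<integral>\<^sup>+\<omega>. ennreal (exp (w \<bullet> (\<Sum>t\<in>I. \<epsilon> t \<omega>))) \<partial>M) = ennreal (exp (b\<^sup>2 / 2))" .
  \<comment> \<open>The tail event forces \<open>w \<bullet> x\<close> to be at least
    \<open>b\<^sup>2\<close>, the level at which Markov's inequality is applied.\<close>
  have ge1: "1 \<le> ennreal (exp (- b\<^sup>2)) * ennreal (exp (w \<bullet> x))"
    if "v \<bullet> x \<le> - (sqrt m * b)" for x
  proof -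
    have "(b / sqrt m) * (v \<bullet> x) \<le> (b / sqrt m) * - (sqrt m * b)"
      using that b by (intro mult_left_mono) auto
    then have "(b / sqrt m) * (v \<bullet> x) \<le> - b\<^sup>2"
      using m by (simp add: power2_eq_square)
    then have "1 \<le> exp (- b\<^sup>2) * exp (w \<bullet> x)"
      unfolding exp_add[symmetric] by (simp add: w_def)
    then have "ennreal 1 \<le> ennreal (exp (- b\<^sup>2) * exp (w \<bullet> x))"
      by (rule ennreal_leI)
    then show ?thesis
      by (simp add: ennreal_mult)
  qed
  have "emeasure M {\<omega> \<in> space M. v \<bullet> (\<Sum>t\<in>I. \<epsilon> t \<omega>) \<le> - (sqrt m * b)}
      \<le> emeasure M {\<omega> \<in> space M.
          1 \<le> ennreal (exp (- b\<^sup>2)) * ennreal (exp (w \<bullet> (\<Sum>t\<in>I. \<epsilon> t \<omega>)))}"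
    using ge1 by (intro emeasure_mono) auto
  also have "\<dots> \<le> ennreal (exp (- b\<^sup>2))
      * (\<integral>\<^sup>+\<omega>. ennreal (exp (w \<bullet> (\<Sum>t\<in>I. \<epsilon> t \<omega>))) * indicator (space M) \<omega> \<partial>M)"
    using nn_integral_Markov_inequality[of "\<lambda>\<omega>. ennreal (exp (w \<bullet> (\<Sum>t\<in>I. \<epsilon> t \<omega>)))" "space M" M]
    by simp
  also have "(\<integral>\<^sup>+\<omega>. ennreal (exp (w \<bullet> (\<Sum>t\<in>I. \<epsilon> t \<omega>))) * indicator (space M) \<omega> \<partial>M)
      = ennreal (exp (b\<^sup>2 / 2))"
    unfolding mgf[symmetric] by (rule nn_integral_cong) simp
  also have "ennreal (exp (- b\<^sup>2)) * ennreal (exp (b\<^sup>2 / 2)) = ennreal (exp (- b\<^sup>2 / 2))"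
    unfolding ennreal_mult[symmetric, OF exp_ge_zero exp_ge_zero] exp_add[symmetric] by simp
  finally show ?thesis
    unfolding I_def by (simp add: emeasure_eq_measure)
qed

section \<open>Pathwise detection at the true change point\<close>

text \<open>The infimum of a nonempty set in \<open>enat\<close> is attained, and that of the empty
  set is infinite, hence above every \<open>enat N\<close>. This trades the infimum for finitely
  many conditions on the statistic.\<close>

lemma detection_time_le_iff:
  "detection_time a c y \<le> enat N \<longleftrightarrow> (\<exists>n\<le>N. \<exists>\<sigma><n. thresholded_stat a y \<sigma> n \<ge> c)"
proof
  assume le: "detection_time a c y \<le> enat N"
  let ?A = "enat ` {n. \<exists>\<sigma><n. thresholded_stat a y \<sigma> n \<ge> c}"
  have "?A \<noteq> {}"
    using le by (intro notI) (simp add: detection_time_def Inf_enat_def)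
  then obtain k where "k \<in> ?A"
    by (meson ex_in_conv)
  then have "detection_time a c y \<in> ?A"
    unfolding detection_time_def by (rule wellorder_InfI)
  then show "\<exists>n\<le>N. \<exists>\<sigma><n. thresholded_stat a y \<sigma> n \<ge> c"
    using le by auto
next
  assume "\<exists>n\<le>N. \<exists>\<sigma><n. thresholded_stat a y \<sigma> n \<ge> c"
  then obtain n where n: "n \<le> N" "\<exists>\<sigma><n. thresholded_stat a y \<sigma> n \<ge> c"
    by blast
  then have "detection_time a c y \<le> enat n"
    unfolding detection_time_def by (intro Inf_lower) auto
  then show "detection_time a c y \<le> enat N"
    by (rule order_trans) (simp add: n(1))
qed

lemma sum_le_thresholded_stat:
  assumes "\<And>i. i \<in> J \<Longrightarrow> a \<le> \<bar>cusum y \<tau> n i\<bar>"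
  shows "(\<Sum>i\<in>J. (cusum y \<tau> n i)\<^sup>2) \<le> thresholded_stat a y \<tau> n"
proof -
  have "(\<Sum>i\<in>J. (cusum y \<tau> n i)\<^sup>2)
      = (\<Sum>i\<in>J. (cusum y \<tau> n i)\<^sup>2 * (if \<bar>cusum y \<tau> n i\<bar> \<ge> a then 1 else 0))"
    using assms by (intro sum.cong) auto
  also have "\<dots> \<le> thresholded_stat a y \<tau> n"
    unfolding thresholded_stat_def by (intro sum_mono2) auto
  finally show ?thesis .
qed

lemma cusum_mean_shift:
  "cusum (mean_shift \<tau> \<delta> e) \<tau> (\<tau> + m) i
      = sqrt m * \<delta> $ i + (\<Sum>t = \<tau> + 1..\<tau> + m. e t) $ i / sqrt m"
proof -
  have "(\<Sum>t = \<tau> + 1..\<tau> + m. mean_shift \<tau> \<delta> e t $ i)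
      = (\<Sum>t = \<tau> + 1..\<tau> + m. \<delta> $ i + e t $ i)"
    by (intro sum.cong) (auto simp: mean_shift_def)
  also have "\<dots> = m * \<delta> $ i + (\<Sum>t = \<tau> + 1..\<tau> + m. e t) $ i"
    by (simp add: sum.distrib)
  finally have "cusum (mean_shift \<tau> \<delta> e) \<tau> (\<tau> + m) i
      = (m * \<delta> $ i + (\<Sum>t = \<tau> + 1..\<tau> + m. e t) $ i) / sqrt m"
    by (simp add: cusum_def)
  also have "\<dots> = m / sqrt m * \<delta> $ i + (\<Sum>t = \<tau> + 1..\<tau> + m. e t) $ i / sqrt m"
    by (simp add: add_divide_distrib)
  \<comment> \<open>\<open>m / sqrt m = sqrt m\<close> holds at \<open>m = 0\<close> as well, since
    division by 0 yields 0.\<close>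
  finally show ?thesis
    by (simp only: real_div_sqrt of_nat_0_le_iff)
qed

text \<open>Weighted AM-GM: \<open>2 x y \<le> x\<^sup>2 / 2 + 2 y\<^sup>2\<close>.\<close>
lemma add_le_of_three_quarters:
  fixes x y s :: real
  assumes "3 / 4 * (2 * x\<^sup>2 + 4 * y\<^sup>2) \<le> s\<^sup>2" and "s \<ge> 0"
  shows "x + y \<le> s"
proof (rule power2_le_imp_le[OF _ assms(2)])
  have "0 \<le> (x - 2 * y)\<^sup>2"
    by simp
  then show "(x + y)\<^sup>2 \<le> s\<^sup>2"
    using assms(1) by (simp add: power2_eq_square algebra_simps)
qed


text \<open>The sequence \<open>e\<close> is arbitrary here; randomness will enter only through the
  noise hypotheses. Orienting each axis by the sign of the shift makes one-sided noise bounds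
  sufficient. The threshold \<open>a\<close> may be negative, and \<open>\<bar>a\<bar>\<close>
  matches the \<open>a\<^sup>2\<close> in the delay bound.\<close>

lemma thresholded_stat_ge:
  fixes \<delta> :: "real ^ 'p"
  assumes m: "m \<ge> 1" and c: "c \<ge> 0"
    and D: "D = (\<chi> j. if j \<in> J then \<delta> $ j else 0)" "D \<noteq> 0"
    and coord: "\<And>j. j \<in> J \<Longrightarrow> \<bar>a\<bar> + b \<le> sqrt m * \<bar>\<delta> $ j\<bar>"
    and total: "sqrt c + b \<le> sqrt m * norm D"
    and G: "G = (\<Sum>t = \<tau> + 1..\<tau> + m. e t)"
    and noise_coord: "\<And>j. j \<in> J \<Longrightarrow> - (sqrt m * b) < axis j (sgn (\<delta> $ j)) \<bullet> G"
    and noise_total: "- (sqrt m * b) < (D /\<^sub>R norm D) \<bullet> G"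
  shows "c \<le> thresholded_stat a (mean_shift \<tau> \<delta> e) \<tau> (\<tau> + m)"
proof -
  define x where "x i = cusum (mean_shift \<tau> \<delta> e) \<tau> (\<tau> + m) i" for i
  have x: "x i = sqrt m * \<delta> $ i + G $ i / sqrt m" for i
    unfolding x_def G by (rule cusum_mean_shift)
  have m_pos: "sqrt m > 0"
    using m by simp
  have scaled: "- b < r / sqrt m" if "- (sqrt m * b) < r" for r
    using that m_pos by (simp add: field_simps)
  have large: "a \<le> \<bar>x j\<bar>" if j: "j \<in> J" for j
  proof -
    have "- b < sgn (\<delta> $ j) * G $ j / sqrt m"
      using scaled[OF noise_coord[OF j]] by (simp add: inner_axis')
    moreover have "sgn (\<delta> $ j) * x j = sqrt m * \<bar>\<delta> $ j\<bar> + sgn (\<delta> $ j) * G $ j / sqrt m"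
      by (simp add: x abs_sgn algebra_simps)
    moreover have "sgn (\<delta> $ j) * x j \<le> \<bar>x j\<bar>"
      by (cases "\<delta> $ j" "0 :: real" rule: linorder_cases) auto
    ultimately show ?thesis
      using coord[OF j] by linarith
  qed
  define u where "u = D /\<^sub>R norm D"
  have u_out: "u $ i = 0" if "i \<notin> J" for i
    using that by (simp add: u_def D(1))
  \<comment> \<open>As \<open>u\<close> vanishes off \<open>J\<close>, sums over \<open>J\<close>
    are full inner products, so the noise bound in the direction of \<open>D\<close> applies to
    them.\<close>
  have inner_u: "(\<Sum>i\<in>J. u $ i * v $ i) = u \<bullet> v" for v
    unfolding inner_vec_def by (rule sum.mono_neutral_cong_left) (auto simp: u_out)
  have "u \<bullet> \<delta> = (\<Sum>i\<in>J. u $ i * D $ i)"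
    unfolding inner_u[symmetric] by (simp add: D(1))
  also have "\<dots> = norm D"
    unfolding inner_u unfolding u_def using D(2)
    by (simp flip: power2_norm_eq_inner) (simp add: power2_eq_square)
  finally have u_delta: "u \<bullet> \<delta> = norm D" .
  have "norm u = 1"
    using D(2) by (simp add: u_def)
  then have u_unit: "(\<Sum>i\<in>J. (u $ i)\<^sup>2) = 1"
    using inner_u[of u] by (simp add: power2_eq_square norm_eq_1)
  have "(\<Sum>i\<in>J. u $ i * x i)
      = sqrt m * (\<Sum>i\<in>J. u $ i * \<delta> $ i) + (\<Sum>i\<in>J. u $ i * G $ i) / sqrt m"
    by (simp add: x sum.distrib sum_distrib_left sum_divide_distrib algebra_simps)
  also have "\<dots> = sqrt m * norm D + u \<bullet> G / sqrt m"
    by (simp add: inner_u u_delta)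
  also have "\<dots> \<ge> sqrt c"
    using scaled[OF noise_total] total unfolding u_def by linarith
  finally have "(sqrt c)\<^sup>2 \<le> (\<Sum>i\<in>J. u $ i * x i)\<^sup>2"
    by (intro power_mono) (use c in auto)
  also have "\<dots> \<le> (\<Sum>i\<in>J. (x i)\<^sup>2)"
    using Cauchy_Schwarz_ineq_sum[of "\<lambda>i. u $ i" x J] by (simp add: u_unit)
  also have "\<dots> \<le> thresholded_stat a (mean_shift \<tau> \<delta> e) \<tau> (\<tau> + m)"
    unfolding x_def by (rule sum_le_thresholded_stat) (use large in \<open>simp add: x_def\<close>)
  finally show ?thesis
    using c by simp
qed

section \<open>Measurability and the probability of detection\<close>

lemma thresholded_stat_measurable:
  assumes "prob_space M" and "iid_std_mvnormal M \<epsilon>"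
  shows "(\<lambda>\<omega>. thresholded_stat a (mean_shift \<tau> \<delta> (\<lambda>t. \<epsilon> t \<omega>)) \<sigma> n) \<in> borel_measurable M"
proof -
  \<comment> \<open>Indices start at \<open>\<sigma> + 1\<close>, so \<open>t \<ge> 1\<close>, where
    measurability of \<open>\<epsilon> t\<close> is known.\<close>
  have shift: "(\<lambda>\<omega>. mean_shift \<tau> \<delta> (\<lambda>t. \<epsilon> t \<omega>) t $ i) \<in> borel_measurable M"
    if "t \<in> {\<sigma> + 1..n}" for t i
    using iid_std_mvnormal_measurable[OF assms, of t] that
    unfolding mean_shift_def cart_eq_inner_axis by (cases "t \<le> \<tau>") auto
  have [measurable]: "(\<lambda>\<omega>. cusum (mean_shift \<tau> \<delta> (\<lambda>t. \<epsilon> t \<omega>)) \<sigma> n i) \<in> borel_measurable M" for i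
    unfolding cusum_def using shift by (intro borel_measurable_times borel_measurable_sum) auto
  show ?thesis
    unfolding thresholded_stat_def by measurable
qed

lemma detection_time_le_sets:
  assumes "prob_space M" and "iid_std_mvnormal M \<epsilon>"
  shows "{\<omega> \<in> space M. detection_time a c (mean_shift \<tau> \<delta> (\<lambda>t. \<epsilon> t \<omega>)) \<le> enat N} \<in> sets M"
proof -
  note thresholded_stat_measurable[OF assms, measurable]
  show ?thesis
    unfolding detection_time_le_iff by measurable
qed

lemma norm_axis: "norm (axis i x :: real ^ 'n) = \<bar>x\<bar>"
  by (simp add: norm_eq_sqrt_inner inner_axis_axis)

lemma prob_detection_time_le:
  fixes \<delta> :: "real ^ 'p"
  assumes M: "prob_space M" and iid: "iid_std_mvnormal M \<epsilon>"
    and m: "m \<ge> 1" and b: "b \<ge> 0"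
    and D: "D = (\<chi> j. if j \<in> J then \<delta> $ j else 0)" "D \<noteq> 0"
    and nz: "\<And>j. j \<in> J \<Longrightarrow> \<delta> $ j \<noteq> 0"
    and coord: "\<And>j. j \<in> J \<Longrightarrow> \<bar>a\<bar> + b \<le> sqrt m * \<bar>\<delta> $ j\<bar>"
    and total: "sqrt (max c 0) + b \<le> sqrt m * norm D"
  shows "measure M {\<omega> \<in> space M. detection_time a c (mean_shift \<tau> \<delta> (\<lambda>t. \<epsilon> t \<omega>)) \<le> enat (\<tau> + m)}
      \<ge> 1 - (card J + 1) * exp (- b\<^sup>2 / 2)"
proof -
  interpret prob_space M by fact
  note [measurable] = detection_time_le_sets[OF M iid]
  define G where "G \<omega> = (\<Sum>t = \<tau> + 1..\<tau> + m. \<epsilon> t \<omega>)" for \<omega>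
  define V where "V = insert (D /\<^sub>R norm D) ((\<lambda>j. axis j (sgn (\<delta> $ j))) ` J)"
  define bad where "bad v = {\<omega> \<in> space M. v \<bullet> G \<omega> \<le> - (sqrt m * b)}" for v
  let ?good = "{\<omega> \<in> space M. detection_time a c (mean_shift \<tau> \<delta> (\<lambda>t. \<epsilon> t \<omega>)) \<le> enat (\<tau> + m)}"
  have [measurable]: "G \<in> borel_measurable M"
    unfolding G_def using iid_std_mvnormal_measurable[OF M iid]
    by (intro borel_measurable_sum) auto
  have bad_sets [measurable]: "bad v \<in> sets M" for v
    unfolding bad_def by measurable
  \<comment> \<open>By \<open>nz\<close> the signs are 1 or -1, so the axis vectors have unit
    length.\<close>
  have norm_V: "norm v = 1" if "v \<in> V" for v
    using that D(2) nz by (auto simp: V_def norm_axis abs_sgn_eq)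
  \<comment> \<open>Only an upper bound on the cardinality holds: for a singleton \<open>J\<close>
    the direction of \<open>D\<close> is itself one of the signed axes.\<close>
  have V: "finite V" "card V \<le> card J + 1"
    unfolding V_def using card_insert_le_m1 card_image_le[of J "\<lambda>j. axis j (sgn (\<delta> $ j))"]
    by (auto simp: card_insert_if)
  have "space M - ?good \<subseteq> (\<Union>v\<in>V. bad v)"
  proof
    fix \<omega> assume \<omega>: "\<omega> \<in> space M - ?good"
    show "\<omega> \<in> (\<Union>v\<in>V. bad v)"
    proof (rule ccontr)
      assume "\<omega> \<notin> (\<Union>v\<in>V. bad v)"
      then have noise: "- (sqrt m * b) < v \<bullet> G \<omega>" if "v \<in> V" for v
        using \<omega> that by (force simp: bad_def)
      have noise_total: "- (sqrt m * b) < (D /\<^sub>R norm D) \<bullet> G \<omega>"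
        by (rule noise) (unfold V_def, rule insertI1)
      have noise_coord: "- (sqrt m * b) < axis j (sgn (\<delta> $ j)) \<bullet> G \<omega>" if "j \<in> J" for j
        by (rule noise) (unfold V_def, intro insertI2 imageI that)
      \<comment> \<open>The pathwise lemma takes a nonnegative level, while \<open>c\<close> may be
        negative.\<close>
      have "max c 0 \<le> thresholded_stat a (mean_shift \<tau> \<delta> (\<lambda>t. \<epsilon> t \<omega>)) \<tau> (\<tau> + m)"
        by (rule thresholded_stat_ge[OF m _ D coord total G_def noise_coord noise_total]) simp_all
      then have "c \<le> thresholded_stat a (mean_shift \<tau> \<delta> (\<lambda>t. \<epsilon> t \<omega>)) \<tau> (\<tau> + m)"
        by simp
      moreover have "\<tau> < \<tau> + m"
        using m by simp
      ultimately show False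
        using \<omega> by (auto simp: detection_time_le_iff)
    qed
  qed
  then have "prob (space M - ?good) \<le> prob (\<Union>v\<in>V. bad v)"
    using V(1) by (intro finite_measure_mono) auto
  also have "\<dots> \<le> (\<Sum>v\<in>V. prob (bad v))"
    using V(1) by (intro measure_UNION_le) auto
  also have "\<dots> \<le> (\<Sum>v\<in>V. exp (- b\<^sup>2 / 2))"
    unfolding bad_def G_def by (intro sum_mono iid_std_mvnormal_tail[OF M iid _ m b] norm_V)
  also have "\<dots> = card V * exp (- b\<^sup>2 / 2)"
    by simp
  also have "\<dots> \<le> (card J + 1) * exp (- b\<^sup>2 / 2)"
    using V(2) by (intro mult_right_mono) auto
  finally show ?thesis
    using prob_compl[of ?good] by simp
qed

text \<open>Each of \<open>z\<close> large coordinates has square above \<open>r\<close>, so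
  together they carry energy at least \<open>z * r = (norm \<delta>)\<^sup>2 / L\<close>. The two
  terms of the maximum then yield the conditions on the total energy and on the single coordinates;
  the factor \<open>L\<close> is the price of the level defining
  \<open>large_coords\<close>.\<close>

lemma prob_detection_time_le_of_delay_bound:
  fixes \<delta> :: "real ^ 'p"
  assumes M: "prob_space M" and iid: "iid_std_mvnormal M \<epsilon>"
    and p: "CARD('p) \<ge> 2" and \<delta>: "norm \<delta> > 0"
    and levels: "sparsity_levels \<delta> \<noteq> {}"
    and \<alpha>: "0 < \<alpha>" "\<alpha> < 1"
    and m: "m \<ge> 1" and bound: "3 / 4 * delay_bound a c \<alpha> \<delta> \<le> m"
  shows "measure M {\<omega> \<in> space M. detection_time a c (mean_shift \<tau> \<delta> (\<lambda>t. \<epsilon> t \<omega>)) \<le> enat (\<tau> + m)}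
      \<ge> 1 - \<alpha>"
proof -
  define z where "z = effective_sparsity \<delta>"
  define L where "L = log 2 (real CARD('p))"
  define \<Lambda> where "\<Lambda> = ln (2 * (real z + 1)) - ln \<alpha>"
  \<comment> \<open>With this choice \<open>4 * b\<^sup>2 = 8 * \<Lambda>\<close> is the logarithmic
    part of both numerators in the delay bound.\<close>
  define b where "b = sqrt (2 * \<Lambda>)"
  have "z \<in> sparsity_levels \<delta>"
    unfolding z_def effective_sparsity_def using levels by (auto intro: LeastI)
  then have z: "z \<ge> 1" "z \<le> card (large_coords \<delta> z)"
    by (auto simp: sparsity_levels_def)
  \<comment> \<open>The large coordinates are cut down to exactly \<open>z\<close>, so that the
    union bound counts \<open>z + 1\<close> events.\<close>
  then obtain J where J: "J \<subseteq> large_coords \<delta> z" "card J = z"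
    by (meson obtain_subset_with_card_n)
  have L: "L \<ge> 1"
    using p by (simp add: L_def le_log_iff)
  have \<Lambda>_eq: "\<Lambda> = ln (2 * (z + 1) / \<alpha>)"
    using \<alpha> by (simp add: \<Lambda>_def ln_div)
  have \<Lambda>: "\<Lambda> \<ge> 0"
    unfolding \<Lambda>_eq using \<alpha> by (intro ln_ge_zero) (simp add: field_simps)
  have b: "b \<ge> 0" "b\<^sup>2 = 2 * \<Lambda>"
    using \<Lambda> by (auto simp: b_def)
  have bound': "3 / 4 * (L * ((2 * c + 8 * \<Lambda>) / (norm \<delta>)\<^sup>2)) \<le> m"
      "3 / 4 * (L * ((2 * a\<^sup>2 + 8 * \<Lambda>) / ((norm \<delta>)\<^sup>2 / z))) \<le> m"
  proof -
    have "delay_bound a c \<alpha> \<delta>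
        = L * max ((2 * c + 8 * \<Lambda>) / (norm \<delta>)\<^sup>2) ((2 * a\<^sup>2 + 8 * \<Lambda>) / ((norm \<delta>)\<^sup>2 / z))"
      by (simp add: delay_bound_def Let_def z_def L_def \<Lambda>_def algebra_simps)
    moreover have "L * x \<le> L * max x y" "L * y \<le> L * max x y" for x y
      using L by (auto intro: mult_left_mono)
    ultimately have "L * ((2 * c + 8 * \<Lambda>) / (norm \<delta>)\<^sup>2) \<le> delay_bound a c \<alpha> \<delta>"
      "L * ((2 * a\<^sup>2 + 8 * \<Lambda>) / ((norm \<delta>)\<^sup>2 / z)) \<le> delay_bound a c \<alpha> \<delta>"
      by metis+
    then show "3 / 4 * (L * ((2 * c + 8 * \<Lambda>) / (norm \<delta>)\<^sup>2)) \<le> m"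
      "3 / 4 * (L * ((2 * a\<^sup>2 + 8 * \<Lambda>) / ((norm \<delta>)\<^sup>2 / z))) \<le> m"
      using bound by linarith+
  qed
  define r where "r = (norm \<delta>)\<^sup>2 / (z * L)"
  have r: "r > 0"
    using \<delta> z L by (simp add: r_def)
  have energy: "3 / 4 * (2 * c + 8 * \<Lambda>) \<le> m * (z * r)" "3 / 4 * (2 * a\<^sup>2 + 8 * \<Lambda>) \<le> m * r"
    using bound' \<delta> z L by (simp_all add: r_def field_simps)
  have sq: "r < (\<delta> $ j)\<^sup>2" if "j \<in> J" for j
  proof -
    have "sqrt r < \<bar>\<delta> $ j\<bar>"
      using that J(1) \<delta> by (auto simp: large_coords_def r_def L_def real_sqrt_divide)
    then show ?thesis
      by (metis real_sqrt_abs real_sqrt_less_iff)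
  qed
  define D where "D = (\<chi> j. if j \<in> J then \<delta> $ j else 0)"
  have "z * r = (\<Sum>j\<in>J. r)"
    by (simp add: J(2))
  also have "\<dots> \<le> (\<Sum>j\<in>J. (\<delta> $ j)\<^sup>2)"
    by (intro sum_mono less_imp_le sq)
  also have "\<dots> = (norm D)\<^sup>2"
    unfolding power2_norm_eq_inner inner_vec_def
    by (rule sum.mono_neutral_cong_left) (auto simp: D_def power2_eq_square)
  finally have D_ge: "z * r \<le> (norm D)\<^sup>2" .
  then have D_nz: "D \<noteq> 0"
    using r z(1) by (auto simp: mult_le_0_iff)
  have coord: "\<bar>a\<bar> + b \<le> sqrt m * \<bar>\<delta> $ j\<bar>" if "j \<in> J" for j
  proof (rule add_le_of_three_quarters)
    have "m * r \<le> m * (\<delta> $ j)\<^sup>2"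
      using sq[OF that] by (intro mult_left_mono) auto
    then show "3 / 4 * (2 * \<bar>a\<bar>\<^sup>2 + 4 * b\<^sup>2) \<le> (sqrt m * \<bar>\<delta> $ j\<bar>)\<^sup>2"
      using energy(2) by (simp add: b(2) power_mult_distrib)
  qed simp
  have total: "sqrt (max c 0) + b \<le> sqrt m * norm D"
  proof (rule add_le_of_three_quarters)
    \<comment> \<open>For negative \<open>c\<close> the first term of the maximum is too weak; the
      part in \<open>\<Lambda>\<close> is then taken from the second term, using
      \<open>z \<ge> 1\<close>.\<close>
    have "m * r \<le> m * (z * r)"
      using r z(1) by (intro mult_left_mono) auto
    then have "3 / 4 * (8 * \<Lambda>) \<le> m * (z * r)"
      using energy(2) zero_le_power2[of a] by argo
    then have "3 / 4 * (2 * max c 0 + 8 * \<Lambda>) \<le> m * (z * r)"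
      using energy(1) by (cases "c \<ge> 0") (simp_all only: max_absorb1 max_absorb2 not_le less_imp_le mult_zero_right add_0)
    also have "\<dots> \<le> m * (norm D)\<^sup>2"
      using D_ge by (intro mult_left_mono) auto
    finally show "3 / 4 * (2 * (sqrt (max c 0))\<^sup>2 + 4 * b\<^sup>2) \<le> (sqrt m * norm D)\<^sup>2"
      by (simp add: b(2) power_mult_distrib)
  qed simp
  have "(card J + 1) * exp (- b\<^sup>2 / 2) = \<alpha> / 2"
    using \<alpha> z(1) by (simp add: J(2) b(2) \<Lambda>_eq exp_minus field_simps)
  moreover have "\<delta> $ j \<noteq> 0" if "j \<in> J" for j
    using sq[OF that] r by auto
  ultimately show ?thesis
    using prob_detection_time_le[OF M iid m b(1) D_def D_nz _ coord total, of \<tau>] \<alpha> by simp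
qed

theorem proposition10:
  fixes M :: "'w measure" and \<epsilon> :: "nat \<Rightarrow> 'w \<Rightarrow> real ^ 'p"
    and \<delta> :: "real ^ 'p" and \<tau> :: nat and a c \<alpha> :: real
  assumes "prob_space M"
    and "iid_std_mvnormal M \<epsilon>"
    and "CARD('p) \<ge> 2"
    and "norm \<delta> > 0"
    and "sparsity_levels \<delta> \<noteq> {}"
    and "0 < \<alpha>" and "\<alpha> < 1"
  shows "(delay_bound a c \<alpha> \<delta> > 3 \<longrightarrow>
           measure M {\<omega> \<in> space M.
             ereal_of_enat (detection_time a c (mean_shift \<tau> \<delta> (\<lambda>t. \<epsilon> t \<omega>))) - ereal (real \<tau>)
               < ereal (delay_bound a c \<alpha> \<delta>)} \<ge> 1 - \<alpha>) \<and>
         measure M {\<omega> \<in> space M.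
           ereal_of_enat (detection_time a c (mean_shift \<tau> \<delta> (\<lambda>t. \<epsilon> t \<omega>))) - ereal (real \<tau>)
             \<le> ereal (real_of_int \<lceil>delay_bound a c \<alpha> \<delta>\<rceil>)} \<ge> 1 - \<alpha>"
proof -
  let ?B = "delay_bound a c \<alpha> \<delta>"
  note delay = prob_detection_time_le_of_delay_bound[OF assms]
  \<comment> \<open>An integer delay below \<open>?B\<close> is at most
    \<open>\<lceil>?B\<rceil> - 1\<close>. The subtraction is in \<open>ereal\<close>, so an alarm
    before the change has negative delay and lies in both events; \<open>T = \<infinity>\<close>
    lies in neither.\<close>
  have lt_iff: "ereal_of_enat T - ereal (real \<tau>) < ereal ?B \<longleftrightarrow> T \<le> enat (\<tau> + nat (\<lceil>?B\<rceil> - 1))"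
    if "?B > 3" for T
  proof (cases T)
    case (enat k)
    have "real k - real \<tau> < ?B \<longleftrightarrow> int k - int \<tau> < \<lceil>?B\<rceil>"
      by (simp add: less_ceiling_iff)
    then show ?thesis
      using that enat by (auto simp: less_ceiling_iff) linarith+
  qed auto
  \<comment> \<open>Positivity comes from the second term of the maximum, since the first can be
    negative when \<open>c\<close> is. It ensures that the rounded bound allows at least one
    observation.\<close>
  have B_pos: "?B > 0"
  proof -
    have "effective_sparsity \<delta> \<in> sparsity_levels \<delta>"
      unfolding effective_sparsity_def using assms(5) by (auto intro: LeastI)
    then have z: "effective_sparsity \<delta> \<ge> 1"
      by (auto simp: sparsity_levels_def)
    have "ln \<alpha> < 0" "ln (2 * (real (effective_sparsity \<delta>) + 1)) > 0" "log 2 (real CARD('p)) > 0"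
      using assms(3,6,7) by (auto intro: ln_gt_zero)
    then have "2 * a\<^sup>2 - 8 * ln \<alpha> + 8 * ln (2 * (real (effective_sparsity \<delta>) + 1)) > 0"
      using zero_le_power2[of a] by linarith
    then have "(2 * a\<^sup>2 - 8 * ln \<alpha> + 8 * ln (2 * (real (effective_sparsity \<delta>) + 1)))
        / ((norm \<delta>)\<^sup>2 / real (effective_sparsity \<delta>)) > 0"
      using z assms(4) by (intro divide_pos_pos) auto
    then show ?thesis
      unfolding delay_bound_def Let_def
      by (intro mult_pos_pos \<open>log 2 (real CARD('p)) > 0\<close>) (rule less_max_iff_disj[THEN iffD2], rule disjI2)
  qed
  have le_iff: "ereal_of_enat T - ereal (real \<tau>) \<le> ereal (real_of_int \<lceil>?B\<rceil>)
      \<longleftrightarrow> T \<le> enat (\<tau> + nat \<lceil>?B\<rceil>)" for T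
  proof (cases T)
    case (enat k)
    have "real k - real \<tau> \<le> real_of_int \<lceil>?B\<rceil> \<longleftrightarrow> int k - int \<tau> \<le> \<lceil>?B\<rceil>"
      by linarith
    moreover have "\<lceil>?B\<rceil> > 0"
      using B_pos by simp
    ultimately have "real k - real \<tau> \<le> real_of_int \<lceil>?B\<rceil> \<longleftrightarrow> k \<le> \<tau> + nat \<lceil>?B\<rceil>"
      by linarith
    then show ?thesis
      using enat by simp
  qed auto
  show ?thesis
  proof (intro conjI impI)
    assume B: "?B > 3"
    have "\<lceil>?B\<rceil> - 1 \<ge> 3"
      using B by linarith
    \<comment> \<open>A bound in \<open>(k, k + 1]\<close> with \<open>k \<ge> 3\<close> leaves \<open>k\<close> observations, at least three quarters of it.\<close>
    then have "nat (\<lceil>?B\<rceil> - 1) \<ge> 1" "3 / 4 * ?B \<le> nat (\<lceil>?B\<rceil> - 1)"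
      by linarith+
    then show "measure M {\<omega> \<in> space M.
        ereal_of_enat (detection_time a c (mean_shift \<tau> \<delta> (\<lambda>t. \<epsilon> t \<omega>))) - ereal (real \<tau>)
          < ereal ?B} \<ge> 1 - \<alpha>"
      unfolding lt_iff[OF B] by (rule delay)
  next
    have "nat \<lceil>?B\<rceil> \<ge> 1" "3 / 4 * ?B \<le> nat \<lceil>?B\<rceil>"
      using B_pos by linarith+
    then show "measure M {\<omega> \<in> space M.
        ereal_of_enat (detection_time a c (mean_shift \<tau> \<delta> (\<lambda>t. \<epsilon> t \<omega>))) - ereal (real \<tau>)
          \<le> ereal (real_of_int \<lceil>?B\<rceil>)} \<ge> 1 - \<alpha>"
      unfolding le_iff by (rule delay)
  qed
qed

end
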